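(* Let $\lambda>0$, $\sigma>0$, $t\ge 1$, let $y_i=x_i+\epsilon_i$ ($1\le i\le n$) with $\epsilon_1,\dots,\epsilon_n$ i.i.d. $N(0,\sigma^2)$, where $(x_i)_{i=1}^n$ is constant on each of the $K$ intervals $\{n_k,\dots,n_{k+1}-1\}$, $1\le k\le K$, and let $(\hat x_i)_{i=1}^n$ be the minimizer of $$\sum_{i=1}^n(x_i-y_i)^2+\lambda\sum_{i=1}^{n-1}|x_i-x_{i+1}|$$ over $\mathbb{R}^n$. Let $m_k=n_{k+1}-n_k$ and $M_y=2\sigma\sqrt{\log n+\log t}$. Then with probability at least $1-1/t^2$, $$\frac1n\sum_{i=1}^n|\hat x_i-x_i|^2\le \frac{M_y^4}{16\lambda^2}+\frac{8\lambda^2}{n}\sum_{k=1}^K\frac1{m_k}+\frac2n M_y^2\left(4K+K+\sum_{k=1}^K\log m_k\right).$$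
   Context: The true signal $(x_i)_{i=1}^n\in\mathbb{R}^n$ is deterministic and piecewise constant with $K$ pieces: there are integers $1=n_1<n_2<\dots<n_K<n$, with $n_{K+1}=n+1$, such that $x_{n_k}=x_{n_k+1}=\dots=x_{n_{k+1}-1}$ for each $1\le k\le K$. In the optimization problem the symbols $x_i$ denote the optimization variables; in the bound $x_i$ denotes the true signal. The objective is strictly convex, so the minimizer $(\hat x_i)$ is unique. *)

theory Defs
  imports "HOL-Probability.Probability"
begin

text \<open>A vector of R^n is a function on nat read at the indices 1, ..., n. Where the whole space
  R^n is quantified over it is \<open>{1..n} \<rightarrow>\<^sub>E UNIV\<close>, so that minimizers are unique as functions.\<close>

definition tv_objective :: "nat \<Rightarrow> real \<Rightarrow> (nat \<Rightarrow> real) \<Rightarrow> (nat \<Rightarrow> real) \<Rightarrow> real" where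
  "tv_objective n lam y z =
     (\<Sum>i=1..n. (z i - y i)\<^sup>2) + lam * (\<Sum>i=1..<n. \<bar>z i - z (i + 1)\<bar>)"

definition tv_minimizer :: "nat \<Rightarrow> real \<Rightarrow> (nat \<Rightarrow> real) \<Rightarrow> (nat \<Rightarrow> real) \<Rightarrow> bool" where
  "tv_minimizer n lam y z \<longleftrightarrow>
     is_arg_min (tv_objective n lam y) (\<lambda>z. z \<in> {1..n} \<rightarrow>\<^sub>E UNIV) z"

text \<open>The pieces are \<open>{ns k ..< ns (k + 1)}\<close> for \<open>k = 1, ..., K\<close>. The last breakpoint satisfies
  \<open>ns K < n\<close>, and adjacent pieces may carry the same value.\<close>

definition breakpoints :: "nat \<Rightarrow> nat \<Rightarrow> (nat \<Rightarrow> nat) \<Rightarrow> bool" where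
  "breakpoints n K ns \<longleftrightarrow>
     1 \<le> K \<and> ns 1 = 1 \<and> (\<forall>k\<in>{1..<K}. ns k < ns (k + 1)) \<and> ns K < n \<and> ns (K + 1) = n + 1"

definition piecewise_constant :: "nat \<Rightarrow> (nat \<Rightarrow> nat) \<Rightarrow> (nat \<Rightarrow> real) \<Rightarrow> bool" where
  "piecewise_constant K ns x \<longleftrightarrow> (\<forall>k\<in>{1..K}. \<forall>i\<in>{ns k..<ns (k + 1)}. x i = x (ns k))"

end

theory Submission
  imports Defs
begin

text \<open>The noise enters only through its sums over intervals. A sum of \<open>L\<close> independent
  \<open>N(0, \<sigma>\<^sup>2)\<close> variables exceeds \<open>My * sqrt L\<close> in absolute value with probability at most
  \<open>exp (- My\<^sup>2 / (2 * \<sigma>\<^sup>2)) = 1 / (n * t)\<^sup>2\<close>, and \<open>{1..n}\<close> has at most \<open>n\<^sup>2\<close> intervals, so with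
  probability at least \<open>1 - 1 / t\<^sup>2\<close> no interval sum exceeds this level (\<open>interval_sums_prob\<close>).
  Everything else is deterministic on that event.

  Fix a position \<open>i\<close> in a piece \<open>{p..q}\<close> of length \<open>m\<close>, on which the signal is \<open>\<theta>\<close>, and let \<open>J\<close> be
  the longest interval of the piece that contains \<open>i\<close> and on which the minimizer \<open>z\<close> is at least
  \<open>z i\<close>. Lowering \<open>z\<close> on \<open>J\<close> by an infinitesimal amount cannot decrease the objective. At an end
  of \<open>J\<close> inside the piece, \<open>z\<close> drops strictly on leaving \<open>J\<close>, so there the variation decreases;
  at an end shared with the piece it increases by at most the amount of the shift. This first-order
  condition (\<open>sum_residual_le\<close>) compares \<open>card J * (z i - \<theta>)\<close> with a noise sum over \<open>J\<close>:
  \<^item> if both ends of \<open>J\<close> are inside, then \<open>z i - \<theta> \<le> My / sqrt (card J) - lam / card J\<close>, which is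
    at most \<open>My\<^sup>2 / (4 * lam)\<close> whatever the length of \<open>J\<close> is;
  \<^item> if one end is inside, the penalty terms cancel at worst and \<open>z i - \<theta> \<le> My / sqrt (card J)\<close>,
    where \<open>J\<close> reaches from \<open>i\<close> to an end of the piece;
  \<^item> if \<open>J\<close> is the piece, then \<open>z i - \<theta> \<le> My / sqrt m + lam / m\<close>.

  The reflection \<open>z \<mapsto> - z\<close> gives the same bounds for \<open>\<theta> - z i\<close>. Squaring and summing over the piece
  turns the second case into two harmonic sums of length \<open>m\<close>, whence the logarithms
  (\<open>piece_error_le\<close>), and summing over the pieces gives a bound below the claimed one
  (\<open>total_error_le\<close>).

  The event of the theorem also has to be measurable. The minimizer is a Lipschitz function of the
  data by strong convexity of the objective, so it is a measurable function of \<open>\<omega>\<close>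
  (\<open>minimizer_measurable\<close>).\<close>

section \<open>Shifting the minimizer on an interval\<close>

text \<open>The objective reads only the indices \<open>1, ..., n\<close>, so competitors may be arbitrary functions.
  Minimality is used in this form below, since perturbed minimizers are then competitors as they
  are.\<close>
lemma tv_minimizer_le:
  assumes "tv_minimizer n lam y z"
  shows "tv_objective n lam y z \<le> tv_objective n lam y w"
proof -
  have "tv_objective n lam y (restrict w {1..n}) = tv_objective n lam y w"
    by (simp add: tv_objective_def)
  moreover have "restrict w {1..n} \<in> {1..n} \<rightarrow>\<^sub>E UNIV"
    by simp
  ultimately show ?thesis
    using assms unfolding tv_minimizer_def is_arg_min_linorder by metis
qed

lemma tv_objective_uminus:
  "tv_objective n lam (\<lambda>i. - y i) (\<lambda>i. - z i) = tv_objective n lam y z"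
proof -
  have "(- a - - b)\<^sup>2 = (a - b)\<^sup>2" "\<bar>- a - - b\<bar> = \<bar>a - b\<bar>" for a b :: real
    by (auto simp: power2_eq_square algebra_simps)
  then show ?thesis
    by (simp add: tv_objective_def)
qed

text \<open>This is the first-order optimality condition in the direction of the negative indicator of
  \<open>{a..b}\<close>. A shift by \<open>\<delta>\<close> changes the squares by \<open>- 2 * \<delta> * S\<close> to first order, where \<open>S\<close> is the
  sum on the left, and it affects only the two jumps at the ends of the interval: \<open>ca\<close> and \<open>cb\<close>
  bound their rates of change. The rate is \<open>- 1\<close> where the minimizer drops on leaving the
  interval, provided that \<open>\<delta>\<close> is at most the size of the drop, and there is no jump to
  change at an end of \<open>{1..n}\<close>.\<close>
lemma sum_residual_le:
  fixes lam :: real and z y :: "nat \<Rightarrow> real"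
  assumes min: "\<And>w. tv_objective n lam y z \<le> tv_objective n lam y w"
    and lam: "lam > 0" and ab: "1 \<le> a" "a \<le> b" "b \<le> n"
  defines "ca \<equiv> if a = 1 then 0 else if z (a - 1) < z a then -1 else 1"
    and "cb \<equiv> if b = n then 0 else if z (b + 1) < z b then -1 else 1"
  shows "(\<Sum>i=a..b. z i - y i) \<le> lam / 2 * (ca + cb)"
proof (rule ccontr)
  define S where "S = (\<Sum>i=a..b. z i - y i)"
  define L where "L = real (b + 1 - a)"
  define g where "g = S - lam / 2 * (ca + cb)"
  assume "\<not> ?thesis"
  then have g: "g > 0" by (simp add: g_def S_def)
  have L: "L > 0" using ab by (simp add: L_def)
  \<comment> \<open>For \<open>\<delta> \<le> g / L\<close> the quadratic term \<open>L * \<delta>\<^sup>2\<close> cannot absorb the first-order gain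
    \<open>2 * \<delta> * g\<close>.\<close>
  obtain \<delta> where \<delta>: "\<delta> > 0" "\<delta> \<le> g / L"
    and da: "ca = -1 \<Longrightarrow> \<delta> \<le> z a - z (a - 1)"
    and db: "cb = -1 \<Longrightarrow> \<delta> \<le> z b - z (b + 1)"
  proof
    let ?A = "if ca = -1 then z a - z (a - 1) else 1"
    let ?B = "if cb = -1 then z b - z (b + 1) else 1"
    let ?\<delta> = "min (g / L) (min ?A ?B)"
    have "?A > 0" "?B > 0" by (auto simp: ca_def cb_def)
    then show "?\<delta> > 0" using g L by simp
  qed auto
  define w where "w i = (if i \<in> {a..b} then z i - \<delta> else z i)" for i
  have sq: "(\<Sum>i=1..n. (w i - y i)\<^sup>2) - (\<Sum>i=1..n. (z i - y i)\<^sup>2) = L * \<delta>\<^sup>2 - 2 * \<delta> * S"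
  proof -
    have "(\<Sum>i=1..n. (w i - y i)\<^sup>2) - (\<Sum>i=1..n. (z i - y i)\<^sup>2)
        = (\<Sum>i=1..n. if i \<in> {a..b} then \<delta>\<^sup>2 - 2 * \<delta> * (z i - y i) else 0)"
      unfolding sum_subtractf[symmetric]
      by (intro sum.cong) (auto simp: w_def power2_eq_square algebra_simps)
    also have "\<dots> = (\<Sum>i=a..b. \<delta>\<^sup>2 - 2 * \<delta> * (z i - y i))"
      using ab by (intro sum.mono_neutral_cong_right) auto
    also have "\<dots> = L * \<delta>\<^sup>2 - 2 * \<delta> * S"
      by (simp add: sum_subtractf L_def S_def flip: sum_distrib_left)
    finally show ?thesis .
  qed
  have tv: "(\<Sum>i=1..<n. \<bar>w i - w (i + 1)\<bar>) - (\<Sum>i=1..<n. \<bar>z i - z (i + 1)\<bar>) \<le> \<delta> * (ca + cb)"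
  proof -
    have "(\<Sum>i=1..<n. \<bar>w i - w (i + 1)\<bar>) - (\<Sum>i=1..<n. \<bar>z i - z (i + 1)\<bar>)
        = (\<Sum>i=1..<n. \<bar>w i - w (i + 1)\<bar> - \<bar>z i - z (i + 1)\<bar>)"
      by (simp add: sum_subtractf)
    also have "\<dots> \<le> (\<Sum>i=1..<n. (if i = a - 1 then \<delta> * ca else 0) + (if i = b then \<delta> * cb else 0))"
    proof (rule sum_mono)
      fix i assume i: "i \<in> {1..<n}"
      consider "i + 1 = a" | "i = b" | "i + 1 < a \<or> i > b" | "a \<le> i" "i < b" by linarith
      then show "\<bar>w i - w (i + 1)\<bar> - \<bar>z i - z (i + 1)\<bar>
          \<le> (if i = a - 1 then \<delta> * ca else 0) + (if i = b then \<delta> * cb else 0)"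
      proof cases
        case 1
        then have "w i = z i" "w (i + 1) = z a - \<delta>" "a - 1 = i" "i \<noteq> b" "a \<noteq> 1"
          using ab i by (auto simp: w_def)
        then show ?thesis using 1 da \<delta> by (auto simp: ca_def split: if_splits)
      next
        case 2
        then have "w i = z b - \<delta>" "w (i + 1) = z (b + 1)" "i \<noteq> a - 1" "b \<noteq> n"
          using ab i by (auto simp: w_def)
        then show ?thesis using 2 db \<delta> by (auto simp: cb_def split: if_splits)
      qed (use ab in \<open>auto simp: w_def\<close>)
    qed
    also have "\<dots> \<le> \<delta> * (ca + cb)"
      using ab by (auto simp: sum.distrib ca_def cb_def algebra_simps)
    finally show ?thesis .
  qed
  have "0 \<le> tv_objective n lam y w - tv_objective n lam y z"
    using min by simp
  also have "\<dots> = (L * \<delta>\<^sup>2 - 2 * \<delta> * S)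
      + lam * ((\<Sum>i=1..<n. \<bar>w i - w (i + 1)\<bar>) - (\<Sum>i=1..<n. \<bar>z i - z (i + 1)\<bar>))"
    using sq by (simp add: tv_objective_def algebra_simps)
  also have "\<dots> \<le> (L * \<delta>\<^sup>2 - 2 * \<delta> * S) + lam * (\<delta> * (ca + cb))"
    using tv lam by simp
  also have "\<dots> = \<delta> * (L * \<delta> - 2 * g)"
    by (simp add: g_def power2_eq_square algebra_simps)
  finally have "L * \<delta> \<ge> 2 * g"
    using \<delta> by (simp add: zero_le_mult_iff)
  moreover have "L * \<delta> \<le> g"
    using \<delta> L by (simp add: field_simps)
  ultimately show False using g by simp
qed

section \<open>Error bounds on one piece\<close>

text \<open>The four cases say which ends of \<open>{a..b}\<close>, the longest interval of the piece around \<open>i\<close> with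
  values at least \<open>z i\<close>, are ends of the piece. On that interval the mean of \<open>z\<close> is at least
  \<open>z i\<close>, so the optimality condition bounds \<open>z i\<close> itself. The alternatives are kept
  apart, since each is squared separately.\<close>
lemma excess_cases:
  fixes lam M \<theta> :: real and z y :: "nat \<Rightarrow> real"
  assumes min: "\<And>w. tv_objective n lam y z \<le> tv_objective n lam y w"
    and lam: "lam > 0" and M: "M \<ge> 0"
    and piece: "1 \<le> p" "p \<le> i" "i \<le> q" "q \<le> n"
    and noise: "\<And>a b. p \<le> a \<Longrightarrow> a \<le> b \<Longrightarrow> b \<le> q \<Longrightarrow>
      (\<Sum>j=a..b. y j - \<theta>) \<le> M * sqrt (real (b + 1 - a))"
  shows "z i - \<theta> \<le> M\<^sup>2 / (4 * lam) \<or> z i - \<theta> \<le> M / sqrt (real (i + 1 - p))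
    \<or> z i - \<theta> \<le> M / sqrt (real (q + 1 - i))
    \<or> z i - \<theta> \<le> M / sqrt (real (q + 1 - p)) + lam / real (q + 1 - p)"
proof -
  define P where "P a \<longleftrightarrow> p \<le> a \<and> (\<forall>j\<in>{a..i}. z i \<le> z j)" for a
  define Q where "Q b \<longleftrightarrow> b \<le> q \<and> (\<forall>j\<in>{i..b}. z i \<le> z j)" for b
  define a where "a = (LEAST a. P a)"
  define b where "b = (GREATEST b. Q b)"
  have "P i" "Q i" using piece by (auto simp: P_def Q_def)
  have "P a" unfolding a_def using \<open>P i\<close> by (rule LeastI)
  have ai: "a \<le> i" unfolding a_def using \<open>P i\<close> by (rule Least_le)
  have "Q b" unfolding b_def using \<open>Q i\<close> by (rule GreatestI_nat[where b = q]) (auto simp: Q_def)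
  have ib: "i \<le> b" unfolding b_def using \<open>Q i\<close> by (rule Greatest_le_nat[where b = q]) (auto simp: Q_def)
  \<comment> \<open>Maximality makes the minimizer drop strictly at every end of the interval that lies inside
    the piece.\<close>
  have left: "z (a - 1) < z a" if "a > p"
  proof -
    have "\<not> P (a - 1)" using not_less_Least[of "a - 1" P] that by (simp add: a_def)
    then have "\<exists>j\<in>{a - 1..i}. z j < z i"
      using that \<open>P a\<close> by (auto simp: P_def not_le)
    then obtain j where "a - 1 \<le> j" "j \<le> i" "z j < z i"
      by auto
    moreover have "j = a - 1"
    proof (rule ccontr)
      assume "j \<noteq> a - 1"
      then have "j \<in> {a..i}" using calculation by auto
      with \<open>P a\<close> \<open>z j < z i\<close> show False by (force simp: P_def)
    qed
    moreover have "z i \<le> z a" using \<open>P a\<close> ai by (simp add: P_def)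
    ultimately show ?thesis by simp
  qed
  have right: "z (b + 1) < z b" if "b < q"
  proof -
    have "\<not> Q (b + 1)"
    proof
      assume "Q (b + 1)"
      then have "b + 1 \<le> b" unfolding b_def by (rule Greatest_le_nat[where b = q]) (auto simp: Q_def)
      then show False by simp
    qed
    then have "\<exists>j\<in>{i..b + 1}. z j < z i"
      using that \<open>Q b\<close> by (auto simp: Q_def not_le)
    then obtain j where "i \<le> j" "j \<le> b + 1" "z j < z i"
      by auto
    moreover have "j = b + 1"
    proof (rule ccontr)
      assume "j \<noteq> b + 1"
      then have "j \<in> {i..b}" using calculation by auto
      with \<open>Q b\<close> \<open>z j < z i\<close> show False by (force simp: Q_def)
    qed
    moreover have "z i \<le> z b" using \<open>Q b\<close> ib by (simp add: Q_def)
    ultimately show ?thesis by simp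
  qed
  define ca :: real where "ca = (if a = 1 then 0 else if z (a - 1) < z a then -1 else 1)"
  define cb :: real where "cb = (if b = n then 0 else if z (b + 1) < z b then -1 else 1)"
  define L where "L = real (b + 1 - a)"
  define e where "e = z i - \<theta>"
  have pa: "p \<le> a" and bq: "b \<le> q" using \<open>P a\<close> \<open>Q b\<close> by (auto simp: P_def Q_def)
  have L: "L > 0" using ai ib by (simp add: L_def)
  have "L * e = (\<Sum>j=a..b. e)" by (simp add: L_def)
  also have "\<dots> \<le> (\<Sum>j=a..b. (z j - y j) + (y j - \<theta>))"
  proof (rule sum_mono)
    fix j assume "j \<in> {a..b}"
    then have "j \<in> {a..i} \<or> j \<in> {i..b}" by auto
    then have "z i \<le> z j" using \<open>P a\<close> \<open>Q b\<close> by (auto simp: P_def Q_def)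
    then show "e \<le> (z j - y j) + (y j - \<theta>)" by (simp add: e_def)
  qed
  also have "\<dots> = (\<Sum>j=a..b. z j - y j) + (\<Sum>j=a..b. y j - \<theta>)" by (rule sum.distrib)
  also have "\<dots> \<le> lam / 2 * (ca + cb) + M * sqrt L"
    using sum_residual_le[OF min lam, of a b] noise[of a b] pa bq piece ai ib
    by (intro add_mono) (auto simp: ca_def cb_def L_def)
  finally have key: "L * e \<le> lam / 2 * (ca + cb) + M * sqrt L" .
  have sq: "sqrt L * sqrt L = L" using L by simp
  have sL: "sqrt L > 0" using L by simp
  \<comment> \<open>If at least one end is a drop, the penalty does not push upwards, and only the noise
    remains.\<close>
  have edge: "e \<le> M / sqrt d" if "ca + cb \<le> 0" "0 < d" "d \<le> L" for d
  proof -
    have "sqrt L * (sqrt L * e) = L * e" using L by (simp flip: mult.assoc)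
    also have "L * e \<le> sqrt L * M"
      using key mult_nonneg_nonpos[of "lam / 2" "ca + cb"] lam that by (simp add: mult.commute)
    finally have "sqrt L * e \<le> M" using sL by simp
    then have "e \<le> M / sqrt L" using sL by (simp add: field_simps)
    also have "\<dots> \<le> M / sqrt d" using that M by (intro divide_left_mono) auto
    finally show ?thesis .
  qed
  consider "p < a" "b < q" | "a = p" "b < q" | "p < a" "b = q" | "a = p" "b = q"
    using pa bq by linarith
  then show ?thesis
  proof cases
    case 1
    then have "ca = -1" "cb = -1" using left right piece by (auto simp: ca_def cb_def)
    then have "L * e \<le> M * sqrt L - lam" using key by simp
    \<comment> \<open>In terms of \<open>r = 1 / sqrt L\<close> this is the maximum of \<open>M * r - lam * r\<^sup>2\<close> over \<open>r\<close>.\<close>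
    also have "\<dots> \<le> L * (M\<^sup>2 / (4 * lam))"
    proof -
      have "0 \<le> (sqrt L * M - 2 * lam)\<^sup>2 / (4 * lam)" using lam by simp
      also have "(sqrt L * M - 2 * lam)\<^sup>2 = L * M\<^sup>2 - 4 * lam * (M * sqrt L) + 4 * lam\<^sup>2"
        using L by (simp add: power2_diff power_mult_distrib algebra_simps)
      also have "\<dots> / (4 * lam) = L * (M\<^sup>2 / (4 * lam)) - (M * sqrt L - lam)"
        using lam by (simp add: field_simps power2_eq_square)
      finally show ?thesis by simp
    qed
    finally have "e \<le> M\<^sup>2 / (4 * lam)" using L by (rule mult_left_le_imp_le)
    then show ?thesis by (simp add: e_def)
  next
    case 2
    then have "cb = -1" "ca \<le> 1" using right piece by (auto simp: ca_def cb_def)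
    then have "e \<le> M / sqrt (real (i + 1 - p))"
      using 2 ib piece by (intro edge) (auto simp: L_def)
    then show ?thesis by (simp add: e_def)
  next
    case 3
    then have "ca = -1" "cb \<le> 1" using left piece by (auto simp: ca_def cb_def)
    then have "e \<le> M / sqrt (real (q + 1 - i))"
      using 3 ai piece by (intro edge) (auto simp: L_def)
    then show ?thesis by (simp add: e_def)
  next
    case 4
    have "ca + cb \<le> 2" by (simp add: ca_def cb_def)
    then have "lam / 2 * (ca + cb) \<le> lam"
      using mult_left_mono[of "ca + cb" 2 "lam / 2"] lam by simp
    then have "L * e \<le> M * sqrt L + lam" using key by simp
    then have "e \<le> (M * sqrt L + lam) / L" using L by (simp add: field_simps)
    also have "\<dots> = M / sqrt L + lam / L" using L by (simp add: add_divide_distrib frac_eq_eq)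
    finally show ?thesis using 4 by (simp add: e_def L_def)
  qed
qed

text \<open>Negating data and minimizer reduces a negative error to a positive one. The square of the
  largest of the four bounds is at most the sum of their squares.\<close>
lemma square_error_le:
  fixes lam M \<theta> :: real and z y :: "nat \<Rightarrow> real"
  assumes min: "\<And>w. tv_objective n lam y z \<le> tv_objective n lam y w"
    and lam: "lam > 0" and M: "M \<ge> 0"
    and piece: "1 \<le> p" "p \<le> i" "i \<le> q" "q \<le> n"
    and noise: "\<And>a b. p \<le> a \<Longrightarrow> a \<le> b \<Longrightarrow> b \<le> q \<Longrightarrow>
      \<bar>\<Sum>j=a..b. y j - \<theta>\<bar> \<le> M * sqrt (real (b + 1 - a))"
  shows "(z i - \<theta>)\<^sup>2 \<le> M ^ 4 / (16 * lam\<^sup>2) + M\<^sup>2 / real (i + 1 - p) + M\<^sup>2 / real (q + 1 - i)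
    + (2 * M\<^sup>2 / real (q + 1 - p) + 2 * lam\<^sup>2 / (real (q + 1 - p))\<^sup>2)"
    (is "_ \<le> ?R")
proof -
  let ?m = "real (q + 1 - p)"
  have m: "?m > 0" using piece by simp
  have main: "e\<^sup>2 \<le> ?R"
    if e: "e \<ge> 0" and cases: "e \<le> M\<^sup>2 / (4 * lam) \<or> e \<le> M / sqrt (real (i + 1 - p))
      \<or> e \<le> M / sqrt (real (q + 1 - i)) \<or> e \<le> M / sqrt ?m + lam / ?m" for e
  proof -
    have nn: "M ^ 4 / (16 * lam\<^sup>2) \<ge> 0" "M\<^sup>2 / real (i + 1 - p) \<ge> 0"
      "M\<^sup>2 / real (q + 1 - i) \<ge> 0" "2 * M\<^sup>2 / ?m + 2 * lam\<^sup>2 / ?m\<^sup>2 \<ge> 0"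
      by simp_all
    have "(M\<^sup>2 / (4 * lam))\<^sup>2 = M ^ 4 / (16 * lam\<^sup>2)"
      by (simp add: power_divide power_mult_distrib)
    moreover have "(M / sqrt (real d))\<^sup>2 = M\<^sup>2 / real d" for d :: nat
      by (simp add: power_divide)
    moreover have "(M / sqrt ?m + lam / ?m)\<^sup>2 \<le> 2 * M\<^sup>2 / ?m + 2 * lam\<^sup>2 / ?m\<^sup>2"
    proof -
      have "(u + v)\<^sup>2 \<le> 2 * u\<^sup>2 + 2 * v\<^sup>2" for u v :: real
        using zero_le_power2[of "u - v"] by (simp add: power2_eq_square algebra_simps)
      from this[of "M / sqrt ?m" "lam / ?m"] show ?thesis
        by (simp add: power_divide)
    qed
    ultimately show ?thesis
      using cases power_mono[OF _ e, of _ 2] nn by (smt (verit))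
  qed
  show ?thesis
  proof (cases "z i - \<theta> \<ge> 0")
    case True
    then show ?thesis
      by (intro main excess_cases[OF min lam M piece]) (use noise in \<open>auto intro: order_trans[OF abs_ge_self]\<close>)
  next
    case False
    have minus: "tv_objective n lam (\<lambda>i. - y i) (\<lambda>i. - z i) \<le> tv_objective n lam (\<lambda>i. - y i) w" for w
      using min[of "\<lambda>i. - w i"] tv_objective_uminus[of n lam y z]
        tv_objective_uminus[of n lam y "\<lambda>i. - w i"] by simp
    have "(\<Sum>j=a..b. - y j - - \<theta>) \<le> M * sqrt (real (b + 1 - a))"
      if "p \<le> a" "a \<le> b" "b \<le> q" for a b
    proof -
      have "(\<Sum>j=a..b. - y j - - \<theta>) = - (\<Sum>j=a..b. y j - \<theta>)"
        by (simp add: sum_negf[symmetric])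
      then show ?thesis using noise[OF that] by linarith
    qed
    from main[OF _ excess_cases[OF minus lam M piece this]] False show ?thesis
      by (simp add: power2_commute)
  qed
qed

lemma harm_le_ln_plus_one:
  assumes "m > 0"
  shows "harm m \<le> ln (real m) + (1 :: real)"
  using assms decseqD[OF decseq_harm_diff_ln, of 0 "m - 1"] by (simp add: harm_def)

text \<open>The distances from a position to the two ends of the piece each run through \<open>1, ..., m\<close>, so
  both distance terms sum to \<open>M\<^sup>2\<close> times a harmonic number.\<close>
lemma piece_error_le:
  fixes lam M \<theta> :: real and z y :: "nat \<Rightarrow> real"
  assumes min: "\<And>w. tv_objective n lam y z \<le> tv_objective n lam y w"
    and lam: "lam > 0" and M: "M \<ge> 0"
    and piece: "1 \<le> p" "p \<le> q" "q \<le> n"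
    and noise: "\<And>a b. p \<le> a \<Longrightarrow> a \<le> b \<Longrightarrow> b \<le> q \<Longrightarrow>
      \<bar>\<Sum>j=a..b. y j - \<theta>\<bar> \<le> M * sqrt (real (b + 1 - a))"
  defines "m \<equiv> real (q + 1 - p)"
  shows "(\<Sum>i=p..q. (z i - \<theta>)\<^sup>2) \<le> m * (M ^ 4 / (16 * lam\<^sup>2)) + 2 * M\<^sup>2 * (ln m + 2) + 2 * lam\<^sup>2 / m"
proof -
  have m: "m > 0" using piece by (simp add: m_def)
  have const: "(\<Sum>i=p..q. c) = m * c" for c :: real
    by (simp add: m_def)
  have "(\<Sum>i=p..q. 1 / real (i + 1 - p)) = harm (q + 1 - p)"
    unfolding harm_def inverse_eq_divide
    by (rule sum.reindex_bij_witness[of _ "\<lambda>k. k + p - 1" "\<lambda>i. i + 1 - p"]) (use piece in auto)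
  moreover have "(\<Sum>i=p..q. 1 / real (q + 1 - i)) = harm (q + 1 - p)"
    unfolding harm_def inverse_eq_divide
    by (rule sum.reindex_bij_witness[of _ "\<lambda>k. q + 1 - k" "\<lambda>i. q + 1 - i"]) (use piece in auto)
  ultimately have harm: "(\<Sum>i=p..q. 1 / real (i + 1 - p)) = harm (q + 1 - p)"
    "(\<Sum>i=p..q. 1 / real (q + 1 - i)) = harm (q + 1 - p)" .
  have hm: "harm (q + 1 - p) \<le> ln m + 1"
    unfolding m_def using piece by (intro harm_le_ln_plus_one) simp
  have "(\<Sum>i=p..q. (z i - \<theta>)\<^sup>2) \<le> (\<Sum>i=p..q. M ^ 4 / (16 * lam\<^sup>2) + M\<^sup>2 * (1 / real (i + 1 - p))
      + M\<^sup>2 * (1 / real (q + 1 - i)) + (2 * M\<^sup>2 / m + 2 * lam\<^sup>2 / m\<^sup>2))"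
    using square_error_le[OF min lam M piece(1) _ _ piece(3) noise]
    by (intro sum_mono) (simp add: m_def)
  also have "\<dots> = m * (M ^ 4 / (16 * lam\<^sup>2)) + M\<^sup>2 * harm (q + 1 - p) + M\<^sup>2 * harm (q + 1 - p)
      + m * (2 * M\<^sup>2 / m + 2 * lam\<^sup>2 / m\<^sup>2)"
    unfolding sum.distrib sum_distrib_left[symmetric] harm const by (simp add: distrib_left)
  also have "m * (2 * M\<^sup>2 / m + 2 * lam\<^sup>2 / m\<^sup>2) = 2 * M\<^sup>2 + 2 * lam\<^sup>2 / m"
    using m by (simp add: field_simps power2_eq_square)
  also have "m * (M ^ 4 / (16 * lam\<^sup>2)) + M\<^sup>2 * harm (q + 1 - p) + M\<^sup>2 * harm (q + 1 - p)
      + (2 * M\<^sup>2 + 2 * lam\<^sup>2 / m)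
    \<le> m * (M ^ 4 / (16 * lam\<^sup>2)) + M\<^sup>2 * (ln m + 1) + M\<^sup>2 * (ln m + 1)
      + (2 * M\<^sup>2 + 2 * lam\<^sup>2 / m)"
    using hm m by (intro add_mono mult_left_mono) auto
  finally show ?thesis by (simp add: algebra_simps)
qed

section \<open>The deterministic error bound\<close>

text \<open>The inequality in the conclusion serves the induction, which splits off the last piece.\<close>
lemma sum_over_pieces:
  fixes f :: "nat \<Rightarrow> 'b::comm_monoid_add" and ns :: "nat \<Rightarrow> nat"
  assumes "\<And>k. k \<in> {1..K} \<Longrightarrow> ns k \<le> ns (k + 1)"
  shows "ns 1 \<le> ns (K + 1) \<and> (\<Sum>i=ns 1..<ns (K + 1). f i) = (\<Sum>k=1..K. \<Sum>i=ns k..<ns (k + 1). f i)"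
  using assms
proof (induction K)
  case 0
  then show ?case by simp
next
  case (Suc K)
  then have "ns 1 \<le> ns (K + 1)"
    and IH: "(\<Sum>i=ns 1..<ns (K + 1). f i) = (\<Sum>k=1..K. \<Sum>i=ns k..<ns (k + 1). f i)"
    by auto
  moreover have "ns (K + 1) \<le> ns (Suc K + 1)"
    using Suc.prems[of "Suc K"] by simp
  ultimately show ?case
    using sum.atLeastLessThan_concat[of "ns 1" "ns (K + 1)" "ns (Suc K + 1)" f] by simp
qed

lemma breakpoints_less:
  assumes "breakpoints n K ns" "k \<in> {1..K}"
  shows "1 \<le> ns k" "ns k < ns (k + 1)" "ns (k + 1) \<le> n + 1"
proof -
  have step: "ns j < ns (j + 1)" if "j \<in> {1..K}" for j
    using assms(1) that by (cases "j = K") (auto simp: breakpoints_def)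
  show "ns k < ns (k + 1)" by (rule step[OF assms(2)])
  have "ns i \<le> ns j" if "i \<le> j" "1 \<le> i" "j \<le> K + 1" for i j
    using that
  proof (induction rule: dec_induct)
    case (step j)
    then show ?case using \<open>\<And>j. j \<in> {1..K} \<Longrightarrow> ns j < ns (j + 1)\<close>[of j] by simp
  qed simp
  from this[of 1 k] this[of "k + 1" "K + 1"] show "1 \<le> ns k" "ns (k + 1) \<le> n + 1"
    using assms by (auto simp: breakpoints_def)
qed

text \<open>Only the lengths of the pieces depend on \<open>k\<close> in the bound for one piece, and they add up to
  \<open>n\<close>.\<close>
lemma total_error_le:
  fixes lam M :: real and z y x :: "nat \<Rightarrow> real"
  assumes min: "\<And>w. tv_objective n lam y z \<le> tv_objective n lam y w"
    and lam: "lam > 0" and M: "M \<ge> 0"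
    and bp: "breakpoints n K ns" and pc: "piecewise_constant K ns x"
    and noise: "\<And>a b. 1 \<le> a \<Longrightarrow> a \<le> b \<Longrightarrow> b \<le> n \<Longrightarrow>
      \<bar>\<Sum>j=a..b. y j - x j\<bar> \<le> M * sqrt (real (b + 1 - a))"
    and m: "\<And>k. k \<in> {1..K} \<Longrightarrow> m k = ns (k + 1) - ns k"
  shows "(\<Sum>i=1..n. (z i - x i)\<^sup>2) \<le> real n * (M ^ 4 / (16 * lam\<^sup>2))
    + 2 * M\<^sup>2 * (2 * real K + (\<Sum>k=1..K. ln (real (m k)))) + 2 * lam\<^sup>2 * (\<Sum>k=1..K. 1 / real (m k))"
proof -
  let ?c = "M ^ 4 / (16 * lam\<^sup>2)"
  note less = breakpoints_less[OF bp]
  have split: "(\<Sum>i=1..n. f i) = (\<Sum>k=1..K. \<Sum>i=ns k..<ns (k + 1). f i)" for f :: "nat \<Rightarrow> real"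
  proof -
    have "(\<Sum>i=ns 1..<ns (K + 1). f i) = (\<Sum>k=1..K. \<Sum>i=ns k..<ns (k + 1). f i)"
      using sum_over_pieces[of K ns f] less by (simp add: less_imp_le)
    then show ?thesis
      using bp by (simp add: breakpoints_def atLeastLessThanSuc_atLeastAtMost)
  qed
  have "(\<Sum>k=1..K. real (m k)) = (\<Sum>k=1..K. \<Sum>i=ns k..<ns (k + 1). 1)"
    by (intro sum.cong) (auto simp: m)
  also have "\<dots> = (\<Sum>i=1..n. 1)"
    by (rule split[symmetric])
  finally have total: "(\<Sum>k=1..K. real (m k)) = real n"
    by simp
  have piece: "(\<Sum>i=ns k..<ns (k + 1). (z i - x i)\<^sup>2)
      \<le> real (m k) * ?c + 2 * M\<^sup>2 * (ln (real (m k)) + 2) + 2 * lam\<^sup>2 * (1 / real (m k))"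
    if k: "k \<in> {1..K}" for k
  proof -
    define q where "q = ns (k + 1) - 1"
    have q: "ns k \<le> q" "q \<le> n" "q + 1 = ns (k + 1)" "{ns k..<ns (k + 1)} = {ns k..q}"
      using less[OF k] unfolding q_def by auto
    have x: "x i = x (ns k)" if "i \<in> {ns k..q}" for i
    proof -
      have "i \<in> {ns k..<ns (k + 1)}"
        using that q(4) by simp
      then show ?thesis
        using pc k unfolding piecewise_constant_def by blast
    qed
    have "\<bar>\<Sum>j=a..b. y j - x (ns k)\<bar> \<le> M * sqrt (real (b + 1 - a))"
      if "ns k \<le> a" "a \<le> b" "b \<le> q" for a b
    proof -
      have "(\<Sum>j=a..b. y j - x (ns k)) = (\<Sum>j=a..b. y j - x j)"
      proof (rule sum.cong[OF refl])
        fix j assume "j \<in> {a..b}"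
        then have "x j = x (ns k)" using that by (intro x) auto
        then show "y j - x (ns k) = y j - x j" by (simp only:)
      qed
      then show ?thesis using noise[of a b] that q less(1)[OF k] by simp
    qed
    from piece_error_le[OF min lam M less(1)[OF k] q(1,2) this]
    have "(\<Sum>i=ns k..q. (z i - x (ns k))\<^sup>2)
      \<le> real (m k) * ?c + 2 * M\<^sup>2 * (ln (real (m k)) + 2) + 2 * lam\<^sup>2 / real (m k)"
      using m[OF k] q(3) by simp
    moreover have "(\<Sum>i=ns k..q. (z i - x (ns k))\<^sup>2) = (\<Sum>i=ns k..<ns (k + 1). (z i - x i)\<^sup>2)"
      unfolding q(4)
    proof (rule sum.cong[OF refl])
      fix i assume "i \<in> {ns k..q}"
      then have "x i = x (ns k)" by (rule x)
      then show "(z i - x (ns k))\<^sup>2 = (z i - x i)\<^sup>2" by (simp only:)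
    qed
    ultimately show ?thesis by simp
  qed
  have "(\<Sum>i=1..n. (z i - x i)\<^sup>2) \<le> (\<Sum>k=1..K. real (m k) * ?c
      + 2 * M\<^sup>2 * (ln (real (m k)) + 2) + 2 * lam\<^sup>2 * (1 / real (m k)))"
    unfolding split by (rule sum_mono) (rule piece)
  also have "\<dots> = real n * ?c + 2 * M\<^sup>2 * (2 * real K + (\<Sum>k=1..K. ln (real (m k))))
      + 2 * lam\<^sup>2 * (\<Sum>k=1..K. 1 / real (m k))"
    unfolding sum.distrib sum_distrib_left[symmetric] sum_distrib_right[symmetric] total by simp
  finally show ?thesis .
qed

section \<open>Measurability of the minimizer\<close>

text \<open>The squares satisfy the parallelogram identity and the variation is convex. This quantitative
  form of strict convexity is what makes minimizers stable under changes of the data.\<close>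
lemma tv_objective_midpoint:
  assumes "lam > 0"
  shows "tv_objective n lam y (\<lambda>i. (z i + w i) / 2)
    \<le> (tv_objective n lam y z + tv_objective n lam y w) / 2 - (\<Sum>i=1..n. (z i - w i)\<^sup>2) / 4"
proof -
  have "(\<Sum>i=1..n. ((z i + w i) / 2 - y i)\<^sup>2)
      = (\<Sum>i=1..n. ((z i - y i)\<^sup>2 + (w i - y i)\<^sup>2) / 2 - (z i - w i)\<^sup>2 / 4)"
    by (intro sum.cong) (auto simp: power2_eq_square field_simps)
  also have "\<dots> = ((\<Sum>i=1..n. (z i - y i)\<^sup>2) + (\<Sum>i=1..n. (w i - y i)\<^sup>2)) / 2
      - (\<Sum>i=1..n. (z i - w i)\<^sup>2) / 4"
    by (simp add: sum_subtractf sum.distrib flip: sum_divide_distrib)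
  finally have 1: "(\<Sum>i=1..n. ((z i + w i) / 2 - y i)\<^sup>2) = \<dots>" .
  have "(\<Sum>i=1..<n. \<bar>(z i + w i) / 2 - (z (i+1) + w (i+1)) / 2\<bar>)
      \<le> (\<Sum>i=1..<n. (\<bar>z i - z (i+1)\<bar> + \<bar>w i - w (i+1)\<bar>) / 2)"
    by (intro sum_mono) (auto simp: field_simps abs_if)
  also have "\<dots> = ((\<Sum>i=1..<n. \<bar>z i - z (i+1)\<bar>) + (\<Sum>i=1..<n. \<bar>w i - w (i+1)\<bar>)) / 2"
    by (simp add: sum.distrib flip: sum_divide_distrib)
  finally have "lam * (\<Sum>i=1..<n. \<bar>(z i + w i) / 2 - (z (i+1) + w (i+1)) / 2\<bar>) \<le> lam * \<dots>"
    using assms by (intro mult_left_mono) auto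
  with 1 show ?thesis
    unfolding tv_objective_def by (simp add: algebra_simps add_divide_distrib)
qed

text \<open>Strict convexity makes each minimizer beat the other one by half their squared distance for its
  own data. In the sum of the two inequalities the variations cancel, and what remains of the squares is
  bilinear in the difference of the minimizers and the difference of the data.\<close>
lemma minimizer_dist_le:
  assumes lam: "lam > 0"
    and z: "\<And>v. tv_objective n lam y z \<le> tv_objective n lam y v"
    and w: "\<And>v. tv_objective n lam y' w \<le> tv_objective n lam y' v"
  shows "L2_set (\<lambda>i. z i - w i) {1..n} \<le> 2 * L2_set (\<lambda>i. y i - y' i) {1..n}"
proof -
  let ?D = "L2_set (\<lambda>i. z i - w i) {1..n}" and ?E = "L2_set (\<lambda>i. y i - y' i) {1..n}"
  have D2: "?D\<^sup>2 = (\<Sum>i=1..n. (z i - w i)\<^sup>2)"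
    by (simp add: L2_set_def sum_nonneg)
  have "tv_objective n lam y z + ?D\<^sup>2 / 2 \<le> tv_objective n lam y w"
    using z[of "\<lambda>i. (z i + w i) / 2"] tv_objective_midpoint[OF lam, of n y z w] D2 by (simp add: field_simps)
  moreover have "tv_objective n lam y' w + ?D\<^sup>2 / 2 \<le> tv_objective n lam y' z"
    using w[of "\<lambda>i. (z i + w i) / 2"] tv_objective_midpoint[OF lam, of n y' z w] D2 by (simp add: field_simps)
  ultimately have "?D\<^sup>2 \<le> (tv_objective n lam y w - tv_objective n lam y z)
      + (tv_objective n lam y' z - tv_objective n lam y' w)"
    by simp
  also have "\<dots> = (\<Sum>i=1..n. ((w i - y i)\<^sup>2 - (z i - y i)\<^sup>2) + ((z i - y' i)\<^sup>2 - (w i - y' i)\<^sup>2))"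
    by (simp add: tv_objective_def sum_subtractf sum.distrib)
  also have "\<dots> \<le> (\<Sum>i=1..n. 2 * (\<bar>z i - w i\<bar> * \<bar>y i - y' i\<bar>))"
  proof (rule sum_mono)
    fix i
    have "((w i - y i)\<^sup>2 - (z i - y i)\<^sup>2) + ((z i - y' i)\<^sup>2 - (w i - y' i)\<^sup>2)
        = 2 * ((z i - w i) * (y i - y' i))"
      by (simp add: power2_eq_square algebra_simps)
    then show "((w i - y i)\<^sup>2 - (z i - y i)\<^sup>2) + ((z i - y' i)\<^sup>2 - (w i - y' i)\<^sup>2)
        \<le> 2 * (\<bar>z i - w i\<bar> * \<bar>y i - y' i\<bar>)"
      using abs_ge_self[of "(z i - w i) * (y i - y' i)"] by (simp add: abs_mult)
  qed
  also have "\<dots> \<le> 2 * (?D * ?E)"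
    unfolding sum_distrib_left[symmetric] using L2_set_mult_ineq by (intro mult_left_mono) auto
  finally have "?D * ?D \<le> ?D * (2 * ?E)"
    by (simp add: power2_eq_square)
  moreover have "?D = 0 \<or> ?D > 0" "?E \<ge> 0"
    using L2_set_nonneg[of "\<lambda>i. z i - w i" "{1..n}"] by (auto simp: less_le L2_set_nonneg)
  ultimately show ?thesis
    using mult_left_le_imp_le[of ?D ?D "2 * ?E"] by auto
qed

text \<open>Such a function factors through \<open>Y\<close>, but the factor is known only on the range of \<open>Y\<close>, which
  need not be measurable. Its sublevel sets are still preimages of open sets: around the
  value \<open>Y \<omega>'\<close> the control leaves room for a whole neighbourhood on which \<open>g\<close> stays below
  \<open>c\<close>.\<close>
lemma borel_measurable_if_controlled:
  fixes Y :: "'a \<Rightarrow> 'b::topological_space" and g :: "'a \<Rightarrow> real" and d :: "'b \<Rightarrow> 'b \<Rightarrow> real"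
  assumes Y: "Y \<in> borel_measurable M"
    and cont: "\<And>v. continuous_on UNIV (\<lambda>u. d u v)" and refl: "\<And>v. d v v = 0"
    and control: "\<And>\<omega> \<omega>'. \<omega> \<in> space M \<Longrightarrow> \<omega>' \<in> space M \<Longrightarrow> \<bar>g \<omega> - g \<omega>'\<bar> \<le> d (Y \<omega>) (Y \<omega>')"
  shows "g \<in> borel_measurable M"
proof (rule borel_measurable_iff_less[THEN iffD2], rule allI)
  fix c
  define U where "U = (\<Union>\<omega>'\<in>{\<omega>\<in>space M. g \<omega> < c}. {u. d u (Y \<omega>') < c - g \<omega>'})"
  have "open U"
    unfolding U_def by (intro open_UN ballI open_Collect_less cont continuous_on_const)
  moreover have "{\<omega>\<in>space M. g \<omega> < c} = Y -` U \<inter> space M"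
  proof (intro equalityI subsetI)
    fix \<omega> assume "\<omega> \<in> {\<omega>\<in>space M. g \<omega> < c}"
    then show "\<omega> \<in> Y -` U \<inter> space M"
      by (auto simp: U_def refl intro!: exI[of _ \<omega>])
  next
    fix \<omega> assume "\<omega> \<in> Y -` U \<inter> space M"
    then obtain \<omega>' where "\<omega> \<in> space M" "\<omega>' \<in> space M" "d (Y \<omega>) (Y \<omega>') < c - g \<omega>'"
      by (auto simp: U_def)
    then show "\<omega> \<in> {\<omega>\<in>space M. g \<omega> < c}"
      using control[of \<omega> \<omega>'] by auto
  qed
  ultimately show "{\<omega>\<in>space M. g \<omega> < c} \<in> sets M"
    using measurable_sets[OF Y] by (metis borel_open)
qed

text \<open>The data are truncated to \<open>Y\<close>, which is \<open>0\<close> outside \<open>{1..n}\<close>, because the other coordinates of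
  \<open>y\<close> need not be measurable.\<close>
lemma minimizer_measurable:
  fixes y xhat :: "'a \<Rightarrow> nat \<Rightarrow> real"
  assumes lam: "lam > 0"
    and y: "\<And>i. i \<in> {1..n} \<Longrightarrow> (\<lambda>\<omega>. y \<omega> i) \<in> borel_measurable M"
    and min: "\<And>\<omega> w. \<omega> \<in> space M \<Longrightarrow> tv_objective n lam (y \<omega>) (xhat \<omega>) \<le> tv_objective n lam (y \<omega>) w"
    and i: "i \<in> {1..n}"
  shows "(\<lambda>\<omega>. xhat \<omega> i) \<in> borel_measurable M"
proof (rule borel_measurable_if_controlled)
  define Y where "Y \<omega> = (\<lambda>i. if i \<in> {1..n} then y \<omega> i else 0)" for \<omega>
  let ?d = "\<lambda>u v. 2 * L2_set (\<lambda>i. u i - v i) {1..n}"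
  show "Y \<in> borel_measurable M"
  proof (rule measurable_coordinatewise_then_product)
    show "(\<lambda>\<omega>. Y \<omega> j) \<in> borel_measurable M" for j
      using y[of j] by (cases "j \<in> {1..n}") (auto simp: Y_def)
  qed
  show "continuous_on UNIV (\<lambda>u. ?d u v)" for v :: "nat \<Rightarrow> real"
    unfolding L2_set_def by (intro continuous_intros continuous_on_product_coordinates)
  show "?d v v = 0" for v :: "nat \<Rightarrow> real"
    by (simp add: L2_set_def)
  fix \<omega> \<omega>' assume \<omega>: "\<omega> \<in> space M" "\<omega>' \<in> space M"
  have "\<bar>xhat \<omega> i - xhat \<omega>' i\<bar> \<le> L2_set (\<lambda>i. xhat \<omega> i - xhat \<omega>' i) {1..n}"
    using i member_le_L2_set[of "{1..n}" i "\<lambda>i. \<bar>xhat \<omega> i - xhat \<omega>' i\<bar>"] by (simp add: L2_set_def)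
  also have "\<dots> \<le> ?d (y \<omega>) (y \<omega>')"
    by (rule minimizer_dist_le[OF lam min[OF \<omega>(1)] min[OF \<omega>(2)]])
  also have "\<dots> = ?d (Y \<omega>) (Y \<omega>')"
    by (simp add: Y_def L2_set_def)
  finally show "\<bar>xhat \<omega> i - xhat \<omega>' i\<bar> \<le> ?d (Y \<omega>) (Y \<omega>')" .
qed

section \<open>Noise sums over all intervals\<close>

text \<open>For \<open>x > 0\<close> the density at \<open>u + x\<close> is at most \<open>exp (- u\<^sup>2 / (2 * s\<^sup>2))\<close> times the density at
  \<open>x\<close>, because the cross term \<open>- u * x / s\<^sup>2\<close> in the exponent is at most \<open>0\<close>. Hence each tail is at most
  this factor times the probability of its half-line, and the two half-lines together have
  probability at most \<open>1\<close>. Bounding the two tails this way avoids a factor \<open>2\<close>.\<close>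
lemma (in prob_space) normal_tail:
  assumes X: "distributed M lborel X (normal_density 0 s)" and s: "s > 0" and u: "u \<ge> 0"
  shows "prob {\<omega> \<in> space M. \<bar>X \<omega>\<bar> > u} \<le> exp (- u\<^sup>2 / (2 * s\<^sup>2))"
proof -
  let ?f = "\<lambda>x. ennreal (normal_density 0 s x)" and ?c = "exp (- u\<^sup>2 / (2 * s\<^sup>2))"
  have [measurable]: "X \<in> borel_measurable M"
    using distributed_measurable[OF X] by simp
  have prob: "emeasure M {\<omega> \<in> space M. P (X \<omega>)} = (\<integral>\<^sup>+x. ?f x * indicator {x. P x} x \<partial>lborel)"
    if "{x. P x} \<in> sets borel" for P
    using distributed_emeasure[OF X, of "{x. P x}"] that
    by (simp add: vimage_def Int_def conj_commute)
  \<comment> \<open>The sign \<open>c\<close> selects the upper or the lower tail.\<close>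
  have shift: "emeasure M {\<omega> \<in> space M. c * X \<omega> > u} \<le> ?c * emeasure M {\<omega> \<in> space M. c * X \<omega> > 0}"
    if c: "\<bar>c\<bar> = 1" for c :: real
  proof -
    have cc: "c * c = 1" using c by (auto simp: abs_if split: if_splits)
    have "emeasure M {\<omega> \<in> space M. c * X \<omega> > u} = (\<integral>\<^sup>+x. ?f x * indicator {x. c * x > u} x \<partial>lborel)"
      by (rule prob) measurable
    also have "\<dots> = (\<integral>\<^sup>+x. ?f (c * u + 1 * x) * indicator {x. c * x > u} (c * u + 1 * x) \<partial>lborel)"
      by (subst nn_integral_real_affine[where c = 1 and t = "c * u"]) auto
    also have "\<dots> \<le> (\<integral>\<^sup>+x. ?c * (?f x * indicator {x. c * x > 0} x) \<partial>lborel)"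
    proof (rule nn_integral_mono)
      fix x :: real
      have eq: "c * (c * u + 1 * x) = u + c * x"
        using cc by (simp add: distrib_left flip: mult.assoc)
      have "normal_density 0 s (c * u + 1 * x) \<le> ?c * normal_density 0 s x" if "c * x > 0"
      proof -
        have "(c * u + 1 * x)\<^sup>2 = (c * c) * u\<^sup>2 + 2 * (u * (c * x)) + x\<^sup>2"
          by (simp add: power2_eq_square algebra_simps)
        then have "(c * u + 1 * x)\<^sup>2 \<ge> u\<^sup>2 + x\<^sup>2"
          using u that cc by simp
        then have "exp (- (c * u + 1 * x)\<^sup>2 / (2 * s\<^sup>2)) \<le> exp (- u\<^sup>2 / (2 * s\<^sup>2) + - x\<^sup>2 / (2 * s\<^sup>2))"
          using s by (simp add: field_simps)
        then show ?thesis
          using s unfolding exp_add by (simp add: normal_density_def divide_right_mono)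
      qed
      then have "?f (c * u + 1 * x) \<le> ?c * ?f x" if "c * x > 0"
        using that by (simp add: ennreal_leI flip: ennreal_mult')
      then show "?f (c * u + 1 * x) * indicator {x. c * x > u} (c * u + 1 * x)
          \<le> ?c * (?f x * indicator {x. c * x > 0} x)"
        using eq by (auto simp: indicator_def)
    qed
    also have "\<dots> = ?c * (\<integral>\<^sup>+x. ?f x * indicator {x. c * x > 0} x \<partial>lborel)"
      by (rule nn_integral_cmult) measurable
    also have "(\<integral>\<^sup>+x. ?f x * indicator {x. c * x > 0} x \<partial>lborel) = emeasure M {\<omega> \<in> space M. c * X \<omega> > 0}"
      by (rule prob[symmetric]) measurable
    finally show ?thesis .
  qed
  have shift': "prob {\<omega> \<in> space M. c * X \<omega> > u} \<le> ?c * prob {\<omega> \<in> space M. c * X \<omega> > 0}"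
    if "\<bar>c\<bar> = 1" for c :: real
    using shift[OF that] by (simp add: emeasure_eq_measure flip: ennreal_mult')
  have "prob {\<omega> \<in> space M. \<bar>X \<omega>\<bar> > u}
      = prob ({\<omega> \<in> space M. 1 * X \<omega> > u} \<union> {\<omega> \<in> space M. (-1) * X \<omega> > u})"
    by (rule arg_cong[where f = prob]) auto
  also have "\<dots> \<le> prob {\<omega> \<in> space M. 1 * X \<omega> > u} + prob {\<omega> \<in> space M. (-1) * X \<omega> > u}"
    by (rule measure_Un_le) measurable
  also have "\<dots> \<le> ?c * prob {\<omega> \<in> space M. 1 * X \<omega> > 0} + ?c * prob {\<omega> \<in> space M. (-1) * X \<omega> > 0}"
    by (intro add_mono shift') auto
  also have "\<dots> = ?c * prob ({\<omega> \<in> space M. 1 * X \<omega> > 0} \<union> {\<omega> \<in> space M. (-1) * X \<omega> > 0})"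
    by (subst finite_measure_Union) (auto simp: distrib_left)
  also have "\<dots> \<le> ?c"
    using mult_left_mono[OF prob_le_1, of ?c] by simp
  finally show ?thesis .
qed

text \<open>The level \<open>u\<close> makes the tail bound for one interval, rescaled by the standard deviation of its
  sum, equal to \<open>1 / (n * t)\<^sup>2\<close>, and there are at most \<open>n\<^sup>2\<close> intervals.\<close>
lemma (in prob_space) interval_sums_prob:
  fixes \<epsilon> :: "nat \<Rightarrow> 'a \<Rightarrow> real"
  assumes indep: "indep_vars (\<lambda>_. borel) \<epsilon> {1..n}"
    and normal: "\<And>i. i \<in> {1..n} \<Longrightarrow> distributed M lborel (\<epsilon> i) (normal_density 0 \<sigma>)"
    and \<sigma>: "\<sigma> > 0" and t: "t \<ge> 1" and n: "n \<ge> 1"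
  defines "u \<equiv> 2 * \<sigma> * sqrt (ln (real n) + ln t)"
  shows "prob {\<omega> \<in> space M. \<forall>a b. 1 \<le> a \<longrightarrow> a \<le> b \<longrightarrow> b \<le> n \<longrightarrow>
      \<bar>\<Sum>i=a..b. \<epsilon> i \<omega>\<bar> \<le> u * sqrt (real (b + 1 - a))} \<ge> 1 - 1 / t\<^sup>2" (is "prob ?G \<ge> _")
proof -
  define I where "I = {(a, b). 1 \<le> a \<and> a \<le> b \<and> b \<le> n}"
  define B where "B = (\<lambda>(a, b). {\<omega> \<in> space M. \<bar>\<Sum>i=a..b. \<epsilon> i \<omega>\<bar> > u * sqrt (real (b + 1 - a))})"
  have [measurable]: "\<epsilon> i \<in> borel_measurable M" if "i \<in> {1..n}" for i
    using distributed_measurable[OF normal[OF that]] by simp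
  have I: "I \<subseteq> {1..n} \<times> {1..n}" by (auto simp: I_def)
  then have fin: "finite I" by (rule finite_subset) simp
  have "card I \<le> card ({1..n} \<times> {1..n})" by (rule card_mono) (use I in auto)
  then have card: "card I \<le> n * n" by (simp add: card_cartesian_product)
  have B_sets: "B ab \<in> events" if "ab \<in> I" for ab
  proof -
    obtain a b where [simp]: "ab = (a, b)" by (cases ab)
    have "(\<lambda>\<omega>. \<Sum>i=a..b. \<epsilon> i \<omega>) \<in> borel_measurable M"
      using that by (intro borel_measurable_sum) (auto simp: I_def)
    then show ?thesis by (simp add: B_def)
  qed
  have ln0: "ln (real n) + ln t \<ge> 0" using n t by simp
  have u0: "u \<ge> 0" using \<sigma> ln0 by (simp add: u_def)
  have B_prob: "prob (B ab) \<le> 1 / (real n * t)\<^sup>2" if "ab \<in> I" for ab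
  proof -
    obtain a b where ab: "ab = (a, b)" by (cases ab)
    then have le: "1 \<le> a" "a \<le> b" "b \<le> n" using that by (auto simp: I_def)
    let ?L = "real (b + 1 - a)"
    have L: "?L > 0" using le by simp
    have "distributed M lborel (\<lambda>\<omega>. \<Sum>i=a..b. \<epsilon> i \<omega>)
        (normal_density (\<Sum>i=a..b. 0) (sqrt (\<Sum>i=a..b. \<sigma>\<^sup>2)))"
      using le \<sigma> normal
      by (intro sum_indep_normal indep_vars_subset[OF indep]) auto
    then have D: "distributed M lborel (\<lambda>\<omega>. \<Sum>i=a..b. \<epsilon> i \<omega>) (normal_density 0 (sqrt (?L * \<sigma>\<^sup>2)))"
      by simp
    have "prob (B ab) \<le> exp (- (u * sqrt ?L)\<^sup>2 / (2 * (sqrt (?L * \<sigma>\<^sup>2))\<^sup>2))"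
      unfolding B_def ab prod.case using L \<sigma> u0 by (intro normal_tail[OF D]) auto
    also have "(u * sqrt ?L)\<^sup>2 = 4 * \<sigma>\<^sup>2 * (ln (real n) + ln t) * ?L"
      using ln0 by (simp add: u_def power_mult_distrib)
    also have "(sqrt (?L * \<sigma>\<^sup>2))\<^sup>2 = ?L * \<sigma>\<^sup>2"
      by (rule real_sqrt_pow2) simp
    also have "- (4 * \<sigma>\<^sup>2 * (ln (real n) + ln t) * ?L) / (2 * (?L * \<sigma>\<^sup>2)) = - 2 * ln (real n * t)"
    proof -
      have "- (4 * \<sigma>\<^sup>2 * s * l) / (2 * (l * \<sigma>\<^sup>2)) = - 2 * s" if "l > 0" for s l :: real
        using that \<sigma> by (simp add: field_simps)
      from this[OF L] show ?thesis using n t by (simp add: ln_mult)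
    qed
    also have "exp \<dots> = 1 / (real n * t)\<^sup>2"
    proof -
      have "exp (2 * ln (real n * t)) = (exp (ln (real n * t)))\<^sup>2" by (rule exp_double)
      then have "exp (2 * ln (real n * t)) = (real n * t)\<^sup>2" using n t by simp
      then show ?thesis by (simp add: exp_minus inverse_eq_divide)
    qed
    finally show ?thesis .
  qed
  have "prob (\<Union>ab\<in>I. B ab) \<le> (\<Sum>ab\<in>I. prob (B ab))"
    using fin B_sets by (intro finite_measure_subadditive_finite) auto
  also have "\<dots> \<le> real (card I) * (1 / (real n * t)\<^sup>2)"
    using B_prob by (rule sum_bounded_above)
  also have "\<dots> \<le> real (n * n) * (1 / (real n * t)\<^sup>2)"
    using card by (intro mult_right_mono) (auto simp del: of_nat_mult)
  also have "\<dots> = 1 / t\<^sup>2"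
    using n t by (simp add: field_simps power2_eq_square)
  finally have "prob (\<Union>ab\<in>I. B ab) \<le> 1 / t\<^sup>2" .
  moreover have "?G = space M - (\<Union>ab\<in>I. B ab)"
    by (auto simp: I_def B_def not_le[symmetric] simp del: not_le)
  moreover have "(\<Union>ab\<in>I. B ab) \<in> events"
    using fin B_sets by auto
  ultimately show ?thesis by (simp add: prob_compl)
qed

section \<open>The error bound with high probability\<close>

theorem corollary3p2:
  fixes M :: "'a measure" and \<epsilon> :: "nat \<Rightarrow> 'a \<Rightarrow> real"
    and n K :: nat and ns m :: "nat \<Rightarrow> nat"
    and x :: "nat \<Rightarrow> real" and y xhat :: "'a \<Rightarrow> nat \<Rightarrow> real"
    and lam \<sigma> t My :: real
  assumes "prob_space M"
    and "lam > 0" and "\<sigma> > 0" and "t \<ge> 1"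
    and "breakpoints n K ns" and "piecewise_constant K ns x"
    and "prob_space.indep_vars M (\<lambda>_. borel) \<epsilon> {1..n}"
    and "\<And>i. i \<in> {1..n} \<Longrightarrow> distributed M lborel (\<epsilon> i) (normal_density 0 \<sigma>)"
    and "\<And>\<omega> i. \<omega> \<in> space M \<Longrightarrow> i \<in> {1..n} \<Longrightarrow> y \<omega> i = x i + \<epsilon> i \<omega>"
    and "\<And>\<omega>. \<omega> \<in> space M \<Longrightarrow> tv_minimizer n lam (y \<omega>) (xhat \<omega>)"
    and "\<And>k. k \<in> {1..K} \<Longrightarrow> m k = ns (k + 1) - ns k"
    and "My = 2 * \<sigma> * sqrt (ln (real n) + ln t)"
  shows "measure M {\<omega> \<in> space M.
            1 / real n * (\<Sum>i=1..n. \<bar>xhat \<omega> i - x i\<bar>\<^sup>2)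
            \<le> My ^ 4 / (16 * lam\<^sup>2)
              + 8 * lam\<^sup>2 / real n * (\<Sum>k=1..K. 1 / real (m k))
              + 2 / real n * My\<^sup>2 * (4 * real K + real K + (\<Sum>k=1..K. ln (real (m k))))}
         \<ge> 1 - 1 / t\<^sup>2"
proof -
  interpret prob_space M by (rule assms(1))
  have n: "n \<ge> 1" and n2: "n > 0"
    using assms(5) by (auto simp: breakpoints_def)
  have ln0: "ln (real n) + ln t \<ge> 0" using n assms(4) by simp
  have My: "My \<ge> 0" using assms(3,12) ln0 by simp
  have min: "tv_objective n lam (y \<omega>) (xhat \<omega>) \<le> tv_objective n lam (y \<omega>) w" if "\<omega> \<in> space M" for \<omega> w
    by (rule tv_minimizer_le[OF assms(10)[OF that]])
  have y_meas: "(\<lambda>\<omega>. y \<omega> i) \<in> borel_measurable M" if "i \<in> {1..n}" for i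
  proof -
    have [measurable]: "\<epsilon> i \<in> borel_measurable M"
      using distributed_measurable[OF assms(8)[OF that]] by simp
    have "(\<lambda>\<omega>. x i + \<epsilon> i \<omega>) \<in> borel_measurable M" by measurable
    then show ?thesis
      using assms(9) that by (subst measurable_cong[of M _ "\<lambda>\<omega>. x i + \<epsilon> i \<omega>"]) auto
  qed
  let ?G = "{\<omega> \<in> space M. \<forall>a b. 1 \<le> a \<longrightarrow> a \<le> b \<longrightarrow> b \<le> n \<longrightarrow>
      \<bar>\<Sum>i=a..b. \<epsilon> i \<omega>\<bar> \<le> My * sqrt (real (b + 1 - a))}"
  let ?loss = "\<lambda>\<omega>. 1 / real n * (\<Sum>i=1..n. \<bar>xhat \<omega> i - x i\<bar>\<^sup>2)"
  let ?R = "My ^ 4 / (16 * lam\<^sup>2) + 8 * lam\<^sup>2 / real n * (\<Sum>k=1..K. 1 / real (m k))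
    + 2 / real n * My\<^sup>2 * (4 * real K + real K + (\<Sum>k=1..K. ln (real (m k))))"
  have "1 - 1 / t\<^sup>2 \<le> prob ?G"
    using interval_sums_prob[OF assms(7,8,3,4) n] by (simp add: assms(12))
  also have "\<dots> \<le> prob {\<omega> \<in> space M. ?loss \<omega> \<le> ?R}"
  proof (rule finite_measure_mono)
    have [measurable]: "(\<lambda>\<omega>. xhat \<omega> i) \<in> borel_measurable M" if "i \<in> {1..n}" for i
      using minimizer_measurable[OF assms(2) y_meas min that] .
    have "?loss \<in> borel_measurable M"
      by (intro borel_measurable_times borel_measurable_const borel_measurable_sum borel_measurable_power
        borel_measurable_abs borel_measurable_diff) measurable
    then show "{\<omega> \<in> space M. ?loss \<omega> \<le> ?R} \<in> events"
      by measurable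
    show "?G \<subseteq> {\<omega> \<in> space M. ?loss \<omega> \<le> ?R}"
    proof
      fix \<omega> assume \<omega>: "\<omega> \<in> ?G"
      let ?H = "\<Sum>k=1..K. 1 / real (m k)" and ?T = "\<Sum>k=1..K. ln (real (m k))"
      have "\<bar>\<Sum>j=a..b. y \<omega> j - x j\<bar> \<le> My * sqrt (real (b + 1 - a))"
        if "1 \<le> a" "a \<le> b" "b \<le> n" for a b
      proof -
        have "(\<Sum>j=a..b. y \<omega> j - x j) = (\<Sum>j=a..b. \<epsilon> j \<omega>)"
          using that \<omega> assms(9) by (intro sum.cong) auto
        then show ?thesis using \<omega> that by auto
      qed
      from total_error_le[OF min assms(2) My assms(5,6) this assms(11)] \<omega>
      have "(\<Sum>i=1..n. \<bar>xhat \<omega> i - x i\<bar>\<^sup>2) \<le> real n * (My ^ 4 / (16 * lam\<^sup>2))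
          + 2 * My\<^sup>2 * (2 * real K + ?T) + 2 * lam\<^sup>2 * ?H"
        by simp
      \<comment> \<open>The deterministic bound has smaller constants: \<open>2\<close> in place of \<open>5\<close> for the
        multiple of \<open>K\<close>, and \<open>2\<close> in place of \<open>8\<close> for that of \<open>lam\<^sup>2\<close>.\<close>
      also have "\<dots> \<le> real n * (My ^ 4 / (16 * lam\<^sup>2)) + 2 * My\<^sup>2 * (4 * real K + real K + ?T)
          + 8 * lam\<^sup>2 * ?H"
        by (intro add_mono mult_left_mono mult_right_mono sum_nonneg) auto
      also have "\<dots> = real n * ?R"
        using n2 by (simp add: distrib_left)
      finally have "?loss \<omega> \<le> ?R"
        using n2 by (simp add: pos_divide_le_eq mult.commute)
      then show "\<omega> \<in> {\<omega> \<in> space M. ?loss \<omega> \<le> ?R}" using \<omega> by simp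
    qed
  qed
  finally show ?thesis .
qed

end
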